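(* Every network exchange game $\langle N,P,U\rangle$ (as defined in the context) has a pair-wise stable pure strategy profile $p^*\in P$.
   Context: **Network.** A social network is $S=(N,E,W)$, with $N$ a finite set of actors, $E$ a set of (undirected) links, and $W:E\to\mathbf{R}_+$ link capacities. There are two types of items $X,Y$, and each actor $i$ owns exactly one type $M_i\in\{X,Y\}$, in amount $|M_i|\ge 0$. Put $A=\{i\in N: M_i=X\}$ and $B=\{j\in N: M_j=Y\}$. The network is bipartite, i.e. $E\subseteq A\times B$. $Nbr(i)$ denotes the set of neighbors of $i$, and $W(i,j)=W(j,i)$. **Utilities.** Each actor $i$ has a utility function $\pi_i:\mathbf{R}_+^2\to\mathbf{R}_+$ of bundles (amount of $X$, amount of $Y$). It is continuous, strictly quasi-concave ($\pi_i(tx+(1-t)y)>\min\{\pi_i(x),\pi_i(y)\}$ for $x\ne y$, $t\in(0,1)$) and strongly monotone ($x\ge y$ coordinatewise and $x\neq y$ imply $\pi_i(x)>\pi_i(y)$). **Exchanges and payoffs.** An exchange between neighbors $i,j$ consists of $i$ giving $m_i$ units of $M_i$ to $j$ and $j$ giving $m_j$ units of $M_j$ to $i$, where $0\le m_i\le|M_i|$, $0\le m_j\le |M_j|$, $m_i+m_j\le W(i,j)$. For neighbors $i,j$ in either order, $V_{ij}(m_i,m_j)$ denotes the payoff to $i$ when $i$ gives $m_i$ and $j$ gives $m_j$ (own amount given is the first argument). Thus $V_{ij}(m_i,m_j)=\pi_i(|M_i|-m_i,m_j)-\pi_i(|M_i|,0)$ if $i\in A$, and $V_{ij}(m_i,m_j)=\pi_i(m_j,|M_i|-m_i)-\pi_i(0,|M_i|)$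 if $i\in B$. **Standing assumption.** For every $(i,j)\in E$ there is an exchange $(m_i,m_j)$ between $i$ and $j$ with $V_{ij}(m_i,m_j)>0$ and $V_{ji}(m_j,m_i)>0$. **Network exchange game $\langle N,P,U\rangle$.** A pure strategy of actor $i$ is $p_i=(j,m_i,m_j)$ with $j\in Nbr(i)$, $0\le m_i\le|M_i|$, $0\le m_j\le|M_j|$, $m_i+m_j\le W(i,j)$: $i$ chooses $j$ as partner, offers to give $m_i$ and asks for $m_j$. $P_i$ is the set of pure strategies of $i$; an actor with no neighbors has a single null strategy. $P=\prod_{i\in N}P_i$. Given $p\in P$, an exchange takes place between neighbors $i$ and $j$ iff $p_i=(j,m_i,m_j)$ and $p_j=(i,m_j,m_i)$ for some $m_i,m_j$; in that case $u_i(p)=V_{ij}(m_i,m_j)$ and $u_j(p)=V_{ji}(m_j,m_i)$. An actor taking part in no exchange has payoff $0$. $U(p)=(u_i(p))_{i\in N}$. **Pair-wise stability.** A profile $p\in P$ is pair-wise stable if 1. $u_i(p)\ge u_i(p_i',p_{-i})$ for all $i\in N$ and $p_i'\in P_i$; and 2. for all neighboring $i,j$ (in either order) and all $p_i'\in P_i$, $p_j'\in P_j$: $u_i(p_i',p_j',p_{-\{i,j\}})>u_i(p)$ implies $u_j(p_i',p_j',p_{-\{i,j\}})<u_j(p)$. *)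

theory Defs
  imports "HOL-Analysis.Analysis"
begin

datatype item = ItemX | ItemY

record 'a network =
  actors :: "'a set"
  links :: "('a \<times> 'a) set"
  capacity :: "'a \<Rightarrow> 'a \<Rightarrow> real"
  item_of :: "'a \<Rightarrow> item"
  amount :: "'a \<Rightarrow> real"
  utility :: "'a \<Rightarrow> real \<times> real \<Rightarrow> real"

definition X_owners :: "'a network \<Rightarrow> 'a set" where
  "X_owners S = {i \<in> actors S. item_of S i = ItemX}"

definition Y_owners :: "'a network \<Rightarrow> 'a set" where
  "Y_owners S = {i \<in> actors S. item_of S i = ItemY}"

text \<open>Each undirected link is listed once in \<open>links S\<close>, with its \<open>X\<close>-owner first;
  \<open>nbrs\<close> is the symmetric neighbour relation.\<close>

definition nbrs :: "'a network \<Rightarrow> 'a \<Rightarrow> 'a set" where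
  "nbrs S i = {j. (i, j) \<in> links S \<or> (j, i) \<in> links S}"

definition bundles :: "(real \<times> real) set" where
  "bundles = {0..} \<times> {0..}"

definition strictly_quasi_concave :: "(real \<times> real \<Rightarrow> real) \<Rightarrow> bool" where
  "strictly_quasi_concave f \<longleftrightarrow>
    (\<forall>x\<in>bundles. \<forall>y\<in>bundles. \<forall>t. x \<noteq> y \<and> 0 < t \<and> t < 1 \<longrightarrow>
       f (t *\<^sub>R x + (1 - t) *\<^sub>R y) > min (f x) (f y))"

text \<open>The order \<open>\<le>\<close> on pairs of reals is the coordinatewise one.\<close>

definition strongly_monotone :: "(real \<times> real \<Rightarrow> real) \<Rightarrow> bool" where
  "strongly_monotone f \<longleftrightarrow>
    (\<forall>x\<in>bundles. \<forall>y\<in>bundles. x \<ge> y \<and> x \<noteq> y \<longrightarrow> f x > f y)"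

definition utility_function :: "(real \<times> real \<Rightarrow> real) \<Rightarrow> bool" where
  "utility_function f \<longleftrightarrow>
    f ` bundles \<subseteq> {0..} \<and> continuous_on bundles f \<and>
    strictly_quasi_concave f \<and> strongly_monotone f"

text \<open>\<open>feasible S i j m m'\<close>: \<open>i\<close> gives \<open>m\<close> units of its item and \<open>j\<close> gives \<open>m'\<close> units of its
  own; \<open>exchange_value S i j m m'\<close> is the resulting payoff to \<open>i\<close>.\<close>

definition feasible :: "'a network \<Rightarrow> 'a \<Rightarrow> 'a \<Rightarrow> real \<Rightarrow> real \<Rightarrow> bool" where
  "feasible S i j m m' \<longleftrightarrow>
    0 \<le> m \<and> m \<le> amount S i \<and> 0 \<le> m' \<and> m' \<le> amount S j \<and> m + m' \<le> capacity S i j"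

definition exchange_value :: "'a network \<Rightarrow> 'a \<Rightarrow> 'a \<Rightarrow> real \<Rightarrow> real \<Rightarrow> real" where
  "exchange_value S i j m m' =
    (case item_of S i of
       ItemX \<Rightarrow> utility S i (amount S i - m, m') - utility S i (amount S i, 0)
     | ItemY \<Rightarrow> utility S i (m', amount S i - m) - utility S i (0, amount S i))"

definition exchange_network :: "'a network \<Rightarrow> bool" where
  "exchange_network S \<longleftrightarrow>
    finite (actors S) \<and>
    links S \<subseteq> X_owners S \<times> Y_owners S \<and>
    (\<forall>(i, j)\<in>links S. 0 \<le> capacity S i j \<and> capacity S i j = capacity S j i) \<and>
    (\<forall>i\<in>actors S. 0 \<le> amount S i \<and> utility_function (utility S i))"

definition beneficial_links :: "'a network \<Rightarrow> bool" where
  "beneficial_links S \<longleftrightarrow>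
    (\<forall>(i, j)\<in>links S. \<exists>m m'. feasible S i j m m' \<and>
       exchange_value S i j m m' > 0 \<and> exchange_value S j i m' m > 0)"

text \<open>\<open>Offer j m m'\<close> proposes to partner \<open>j\<close> to give \<open>m\<close> and asks for \<open>m'\<close> in return.\<close>

datatype 'a strategy = Null | Offer 'a real real

definition strategies :: "'a network \<Rightarrow> 'a \<Rightarrow> 'a strategy set" where
  "strategies S i =
    (if nbrs S i = {} then {Null}
     else {Offer j m m' | j m m'. j \<in> nbrs S i \<and> feasible S i j m m'})"

definition profiles :: "'a network \<Rightarrow> ('a \<Rightarrow> 'a strategy) set" where
  "profiles S = (\<Pi>\<^sub>E i\<in>actors S. strategies S i)"

definition payoff :: "'a network \<Rightarrow> ('a \<Rightarrow> 'a strategy) \<Rightarrow> 'a \<Rightarrow> real" where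
  "payoff S p i =
    (case p i of
       Null \<Rightarrow> 0
     | Offer j m m' \<Rightarrow>
         if j \<in> nbrs S i \<and> p j = Offer i m' m then exchange_value S i j m m' else 0)"

definition pairwise_stable :: "'a network \<Rightarrow> ('a \<Rightarrow> 'a strategy) \<Rightarrow> bool" where
  "pairwise_stable S p \<longleftrightarrow>
    p \<in> profiles S \<and>
    (\<forall>i\<in>actors S. \<forall>s\<in>strategies S i. payoff S p i \<ge> payoff S (p(i := s)) i) \<and>
    (\<forall>i\<in>actors S. \<forall>j\<in>nbrs S i. \<forall>s\<in>strategies S i. \<forall>s'\<in>strategies S j.
       payoff S (p(i := s, j := s')) i > payoff S p i \<longrightarrow>
       payoff S (p(i := s, j := s')) j < payoff S p j)"

end

theory Submission
  imports Defs
begin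

text \<open>When only finitely many contracts are allowed, a stable matching exists as in the theorem of
  Gale and Shapley. The individually rational contracts of a link form a compact set and not being
  blocked by a given contract is a closed condition, so compactness yields a matching that no
  contract blocks to the strict benefit of both sides. A contract that benefits one side strictly
  and leaves the other indifferent is turned into a strict improvement for both by letting the
  indifferent side give slightly less.\<close>

subsection \<open>Finite stable matchings\<close>

text \<open>Ties of \<open>r\<close> are broken by an injective numbering \<open>h\<close>. The new
  rank of an element counts its predecessors in the resulting lexicographic order, so it is strictly
  increasing along that order.\<close>

lemma injective_rank_refinement:
  fixes r :: "'c \<Rightarrow> real"
  assumes "finite C"
  shows "\<exists>r' :: 'c \<Rightarrow> real. inj_on r' C \<and> (\<forall>c\<in>C. \<forall>d\<in>C. r c < r d \<longrightarrow> r' c < r' d)"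
proof -
  obtain h :: "'c \<Rightarrow> nat" where h: "inj_on h C"
    using finite_imp_inj_to_nat_seg[OF assms] by blast
  define less where "less c d \<longleftrightarrow> r c < r d \<or> r c = r d \<and> h c < h d" for c d
  define r' where "r' d = real (card {c \<in> C. less c d})" for d
  have mono: "r' c < r' d" if "c \<in> C" "d \<in> C" "less c d" for c d
  proof -
    have "{b \<in> C. less b c} \<subset> {b \<in> C. less b d}"
      using that by (auto simp: less_def)
    then show ?thesis
      unfolding r'_def using assms by (simp add: psubset_card_mono)
  qed
  have "c = d" if "c \<in> C" "d \<in> C" "r' c = r' d" for c d
  proof -
    have "\<not> less c d" "\<not> less d c"
      using mono[of c d] mono[of d c] that by auto
    then have "h c = h d" by (auto simp: less_def)
    then show ?thesis using h that by (auto dest: inj_onD)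
  qed
  then have "inj_on r' C" by (auto intro: inj_onI)
  moreover have "\<forall>c\<in>C. \<forall>d\<in>C. r c < r d \<longrightarrow> r' c < r' d"
    using mono by (auto simp: less_def)
  ultimately show ?thesis by blast
qed

text \<open>Induction on the set of contracts replaces the rounds of deferred acceptance. Proposers
  (\<open>f\<close>) rank by \<open>r\<close>, responders (\<open>g\<close>) by \<open>s\<close>. If
  the favourites of all proposers go to distinct responders, they form the matching; otherwise a
  contract rejected by a responder is deleted from \<open>C\<close>.\<close>

lemma finite_stable_matching_strict:
  fixes f :: "'c \<Rightarrow> 'a" and g :: "'c \<Rightarrow> 'b" and r s :: "'c \<Rightarrow> real"
  assumes "finite C" "inj_on r C"
  shows "\<exists>M\<subseteq>C. inj_on f M \<and> inj_on g M \<and>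
    (\<forall>c\<in>C. \<exists>d\<in>M. f d = f c \<and> r c \<le> r d \<or> g d = g c \<and> s c \<le> s d)"
  using assms
proof (induction C rule: finite_psubset_induct)
  case (psubset C)
  define T where "T = {c \<in> C. \<forall>d\<in>C. f d = f c \<longrightarrow> r d \<le> r c}"
  have inj_fT: "inj_on f T"
  proof (rule inj_onI)
    fix c d assume "c \<in> T" "d \<in> T" "f c = f d"
    then have "c \<in> C" "d \<in> C" "r c = r d"
      by (auto simp: T_def intro: order_antisym)
    then show "c = d" using psubset.prems by (auto dest: inj_onD)
  qed
  have best: "\<exists>d\<in>T. f d = f c \<and> r c \<le> r d" if "c \<in> C" for c
  proof -
    let ?D = "{d \<in> C. f d = f c}"
    have D: "finite ?D" "?D \<noteq> {}" using psubset.hyps that by auto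
    then have "Max (r ` ?D) \<in> r ` ?D" by (intro Max_in) auto
    then obtain d where "d \<in> ?D" "r d = Max (r ` ?D)" by auto
    moreover from this have "r e \<le> r d" if "e \<in> ?D" for e
      using D that by simp
    ultimately have "d \<in> ?D" "\<And>e. e \<in> ?D \<Longrightarrow> r e \<le> r d" by blast+
    then show ?thesis unfolding T_def using that by (intro bexI[of _ d]) auto
  qed
  show ?case
  proof (cases "inj_on g T")
    case True
    show ?thesis
      by (rule exI[of _ T]) (use True inj_fT best in \<open>auto simp: T_def\<close>)
  next
    case False
    then obtain b d where bd: "b \<in> T" "d \<in> T" "b \<noteq> d" "g b = g d" "s d \<le> s b"
      unfolding inj_on_def by (metis linear)
    \<comment> \<open>Contract \<open>d\<close> can be dropped: \<open>b\<close> is the favourite of its proposer, so whatever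
      dominates \<open>b\<close> is either \<open>b\<close> itself or at least as good for the common responder.\<close>
    have dC: "d \<in> C" "b \<in> C - {d}" using bd by (auto simp: T_def)
    then have "C - {d} \<subset> C" "inj_on r (C - {d})"
      using psubset.prems by (auto intro: inj_on_subset)
    then obtain M where M: "M \<subseteq> C - {d}" "inj_on f M" "inj_on g M"
      and dom: "\<And>c. c \<in> C - {d} \<Longrightarrow> \<exists>e\<in>M. f e = f c \<and> r c \<le> r e \<or> g e = g c \<and> s c \<le> s e"
      using psubset.IH[of "C - {d}"] by blast
    obtain e where e: "e \<in> M" "f e = f b \<and> r b \<le> r e \<or> g e = g b \<and> s b \<le> s e"
      using dom[OF dC(2)] by blast
    have "g e = g d \<and> s d \<le> s e"
    proof (cases "f e = f b \<and> r b \<le> r e")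
      case True
      then have "r e = r b" using bd(1) e(1) M(1) by (force simp: T_def)
      then have "e = b" using psubset.prems e(1) M(1) dC(2) by (auto dest: inj_onD)
      then show ?thesis using bd by simp
    qed (use e bd in auto)
    then have "\<forall>c\<in>C. \<exists>e\<in>M. f e = f c \<and> r c \<le> r e \<or> g e = g c \<and> s c \<le> s e"
      using dom e(1) by (metis DiffI singletonD)
    then show ?thesis using M by blast
  qed
qed

text \<open>Refining \<open>r\<close> to an injective \<open>r'\<close> is harmless:
  \<open>r' c \<le> r' d\<close> excludes \<open>r d < r c\<close>, so domination under
  \<open>r'\<close> is domination under \<open>r\<close>.\<close>

lemma finite_stable_matching:
  fixes f :: "'c \<Rightarrow> 'a" and g :: "'c \<Rightarrow> 'b" and r s :: "'c \<Rightarrow> real"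
  assumes "finite C"
  shows "\<exists>M\<subseteq>C. inj_on f M \<and> inj_on g M \<and>
    (\<forall>c\<in>C. \<exists>d\<in>M. f d = f c \<and> r c \<le> r d \<or> g d = g c \<and> s c \<le> s d)"
proof -
  obtain r' :: "'c \<Rightarrow> real" where r': "inj_on r' C"
    and mono: "\<And>c d. c \<in> C \<Longrightarrow> d \<in> C \<Longrightarrow> r c < r d \<Longrightarrow> r' c < r' d"
    using injective_rank_refinement[OF assms, of r] by blast
  obtain M where M: "M \<subseteq> C" "inj_on f M" "inj_on g M"
    and dom: "\<And>c. c \<in> C \<Longrightarrow> \<exists>d\<in>M. f d = f c \<and> r' c \<le> r' d \<or> g d = g c \<and> s c \<le> s d"
    using finite_stable_matching_strict[OF assms r', of f g s] by blast
  have "\<forall>c\<in>C. \<exists>d\<in>M. f d = f c \<and> r c \<le> r d \<or> g d = g c \<and> s c \<le> s d"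
    using dom mono M(1) by (meson not_less subsetD)
  then show ?thesis using M by blast
qed

subsection \<open>The value of an exchange\<close>

text \<open>Bounding the amount given by \<open>amount S i\<close> keeps the bundle left to
  \<open>i\<close> nonnegative, where the utility is continuous.\<close>

lemma continuous_on_exchange_value:
  assumes "utility_function (utility S i)"
  shows "continuous_on ({0..amount S i} \<times> {0..}) (\<lambda>z. exchange_value S i j (fst z) (snd z))"
proof -
  have u: "continuous_on bundles (utility S i)"
    using assms by (simp add: utility_function_def)
  show ?thesis
  proof (cases "item_of S i")
    case ItemX
    show ?thesis
      unfolding exchange_value_def ItemX item.case
      by (intro continuous_intros continuous_on_compose2[OF u]) (auto simp: bundles_def)
  next
    case ItemY
    show ?thesis
      unfolding exchange_value_def ItemY item.case
      by (intro continuous_intros continuous_on_compose2[OF u]) (auto simp: bundles_def)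
  qed
qed

lemma exchange_value_strict_antimono:
  assumes "utility_function (utility S i)"
    and "0 \<le> m" "m < m'" "m' \<le> amount S i" "0 \<le> k"
  shows "exchange_value S i j m' k < exchange_value S i j m k"
  using assms
  by (cases "item_of S i")
     (auto simp: exchange_value_def utility_function_def strongly_monotone_def bundles_def)

lemma exchange_value_no_trade [simp]: "exchange_value S i j 0 0 = 0"
  by (cases "item_of S i") (auto simp: exchange_value_def)

text \<open>Monotonicity makes a pure gift no better than no trade. Hence whoever gains strictly
  must receive a positive amount.\<close>

lemma exchange_value_gift_le:
  assumes "utility_function (utility S i)" "0 \<le> m" "m \<le> amount S i"
  shows "exchange_value S i j m 0 \<le> 0"
proof (cases "m = 0")
  case True
  then show ?thesis by simp
next
  case False
  then have "exchange_value S i j m 0 < exchange_value S i j 0 0"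
    using assms exchange_value_strict_antimono[of S i 0 m 0 j] by simp
  then show ?thesis by simp
qed

text \<open>A gain of \<open>i\<close> can be shared with its partner: since \<open>i\<close> receives a positive amount,
  the partner may give slightly less, which also respects the capacity.\<close>

lemma exchange_value_receive_less:
  assumes "utility_function (utility S i)" "0 \<le> m" "m \<le> amount S i" "0 \<le> m'"
    and "u < exchange_value S i j m m'" "0 \<le> u"
  shows "\<exists>k. 0 \<le> k \<and> k < m' \<and> u < exchange_value S i j m k"
proof -
  have "m' \<noteq> 0"
    using exchange_value_gift_le[of S i m j] assms by auto
  with assms have m': "0 < m'" by simp
  have "continuous_on {0..} (\<lambda>k. exchange_value S i j m k)"
    using continuous_on_compose2[OF continuous_on_exchange_value[OF assms(1), of j],
        of "{0..}" "\<lambda>k. (m, k)"] assms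
    by (auto simp: continuous_on_Pair image_subset_iff)
  then have "((\<lambda>k. exchange_value S i j m k) \<longlongrightarrow> exchange_value S i j m m') (at m' within {0..})"
    using m' by (auto simp: continuous_on_def)
  then have "eventually (\<lambda>k. u < exchange_value S i j m k) (at m' within {0..})"
    by (rule order_tendstoD) (use assms in auto)
  then obtain d where d: "0 < d"
    "\<And>k. 0 \<le> k \<Longrightarrow> k \<noteq> m' \<Longrightarrow> dist k m' < d \<Longrightarrow> u < exchange_value S i j m k"
    unfolding eventually_at by auto
  \<comment> \<open>Half the radius \<open>d\<close> keeps \<open>k\<close> strictly within the
    neighbourhood of \<open>m'\<close>; the cut at 0 stays below \<open>m'\<close> because
    \<open>m'\<close> is positive.\<close>
  define k where "k = max 0 (m' - d / 2)"
  have "0 \<le> k" "k < m'" "dist k m' < d"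
    using m' d(1) by (auto simp: k_def dist_real_def)
  with d(2)[of k] show ?thesis by blast
qed

subsection \<open>Stable matchings with compact sets of contracts\<close>

text \<open>Tychonoff's theorem, carried over from the abstract product topology to the topology of
  the function type.\<close>

lemma compact_PiE_UNIV:
  fixes T :: "'i \<Rightarrow> 'z::topological_space set"
  assumes "\<And>i. compact (T i)"
  shows "compact (PiE UNIV T)"
proof -
  have "compactin (product_topology (\<lambda>i. euclidean) UNIV) (PiE UNIV T)"
    using assms by (simp add: compactin_PiE)
  then show ?thesis by (simp add: euclidean_product_topology)
qed

lemma closed_PiE_UNIV:
  fixes T :: "'i \<Rightarrow> 'z::topological_space set"
  assumes "\<And>i. closed (T i)"
  shows "closed (PiE UNIV T)"
proof -
  have "PiE UNIV T = (\<Inter>i. (\<lambda>x. x i) -` T i)" by auto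
  also have "closed \<dots>"
    using assms
    by (intro closed_INT ballI closed_vimage) auto
  finally show ?thesis .
qed

text \<open>An outcome is a matching \<open>L\<close> and one contract for every link, including the links outside
  \<open>L\<close>. For fixed \<open>L\<close> the outcomes that a given contract does not block form a closed subset of a
  compact space, so finitely many contracts would already block every \<open>L\<close>.\<close>

lemma compact_stable_matching:
  fixes E :: "('a \<times> 'b) set" and T :: "'a \<times> 'b \<Rightarrow> 'z::t2_space set"
    and v w :: "'a \<times> 'b \<Rightarrow> 'z \<Rightarrow> real"
  assumes "finite E"
    and compact: "\<And>e. e \<in> E \<Longrightarrow> compact (T e)"
    and nonempty: "\<And>e. e \<in> E \<Longrightarrow> T e \<noteq> {}"
    and cont: "\<And>e. e \<in> E \<Longrightarrow> continuous_on (T e) (v e)" "\<And>e. e \<in> E \<Longrightarrow> continuous_on (T e) (w e)"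
  shows "\<exists>L x. L \<subseteq> E \<and> inj_on fst L \<and> inj_on snd L \<and> (\<forall>e\<in>E. x e \<in> T e) \<and>
    (\<forall>e\<in>E. \<forall>z\<in>T e. \<exists>d\<in>L. fst d = fst e \<and> v e z \<le> v d (x d) \<or> snd d = snd e \<and> w e z \<le> w d (x d))"
proof -
  \<comment> \<open>Singletons off \<open>E\<close> make the space of outcomes a product over the
    whole index type, so that it is compact in the function topology.\<close>
  define U where "U e = (if e \<in> E then T e else {undefined})" for e
  define K where "K = PiE UNIV U"
  have K: "x e \<in> T e" if "x \<in> K" "e \<in> E" for x e
    using that PiE_mem[of x UNIV U e] by (simp add: K_def U_def)
  have "compact K"
    unfolding K_def using compact by (intro compact_PiE_UNIV) (simp add: U_def)
  have "closed K"
    unfolding K_def using compact by (intro closed_PiE_UNIV) (simp add: U_def compact_imp_closed)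
  \<comment> \<open>Here \<open>c\<close> is a link together with a contract on it, and
    \<open>N L c\<close> holds the outcomes in which one end of that link already does at least as
    well under \<open>L\<close>. The weak inequalities make this set closed.\<close>
  define N where "N L c = {x \<in> K. \<exists>d\<in>L. fst d = fst (fst c) \<and> v (fst c) (snd c) \<le> v d (x d) \<or>
      snd d = snd (fst c) \<and> w (fst c) (snd c) \<le> w d (x d)}" for L c
  have closed_N: "closed (N L c)" if "L \<subseteq> E" for L c
  proof -
    have coord: "continuous_on K (\<lambda>x. x d)" for d
      by (rule continuous_on_subset[OF continuous_on_product_coordinates]) simp
    have "closed {x \<in> K. v (fst c) (snd c) \<le> v d (x d)}"
         "closed {x \<in> K. w (fst c) (snd c) \<le> w d (x d)}" if "d \<in> L" for d
    proof -
      have "d \<in> E" using that \<open>L \<subseteq> E\<close> by auto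
      then have image: "(\<lambda>x. x d) ` K \<subseteq> T d" using K by blast
      show "closed {x \<in> K. v (fst c) (snd c) \<le> v d (x d)}"
        by (intro continuous_on_closed_Collect_le continuous_on_const \<open>closed K\<close>
            continuous_on_compose2[OF cont(1)[OF \<open>d \<in> E\<close>] coord image])
      show "closed {x \<in> K. w (fst c) (snd c) \<le> w d (x d)}"
        by (intro continuous_on_closed_Collect_le continuous_on_const \<open>closed K\<close>
            continuous_on_compose2[OF cont(2)[OF \<open>d \<in> E\<close>] coord image])
    qed
    moreover have "N L c = (\<Union>d\<in>{d\<in>L. fst d = fst (fst c)}. {x \<in> K. v (fst c) (snd c) \<le> v d (x d)}) \<union>
        (\<Union>d\<in>{d\<in>L. snd d = snd (fst c)}. {x \<in> K. w (fst c) (snd c) \<le> w d (x d)})"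
      by (auto simp: N_def)
    ultimately show ?thesis
      using finite_subset[OF that \<open>finite E\<close>] by (auto intro!: closed_Un closed_UN)
  qed
  define LL where "LL = {L. L \<subseteq> E \<and> inj_on fst L \<and> inj_on snd L}"
  have "finite LL"
    by (rule finite_subset[of _ "Pow E"]) (use \<open>finite E\<close> in \<open>auto simp: LL_def\<close>)
  have "\<exists>L\<in>LL. K \<inter> (\<Inter>c\<in>Sigma E T. N L c) \<noteq> {}"
  proof (rule ccontr)
    assume "\<not> ?thesis"
    then have empty: "K \<inter> (\<Inter>c\<in>Sigma E T. N L c) = {}" if "L \<in> LL" for L
      using that by blast
    have "\<exists>F. finite F \<and> F \<subseteq> Sigma E T \<and> K \<inter> (\<Inter>c\<in>F. N L c) = {}" if "L \<in> LL" for L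
      using compact_imp_fip_image[OF \<open>compact K\<close>, of "Sigma E T" "N L"] closed_N empty[OF that] that
      unfolding LL_def by blast
    then obtain F where F: "\<And>L. L \<in> LL \<Longrightarrow> finite (F L)" "\<And>L. L \<in> LL \<Longrightarrow> F L \<subseteq> Sigma E T"
      "\<And>L. L \<in> LL \<Longrightarrow> K \<inter> (\<Inter>c\<in>F L. N L c) = {}"
      by metis
    \<comment> \<open>One finite set of contracts now blocks every matching at once. A stable
      matching of \<open>G\<close> itself will contradict this.\<close>
    define G where "G = (\<Union>L\<in>LL. F L)"
    have "finite G" "G \<subseteq> Sigma E T"
      using F \<open>finite LL\<close> by (auto simp: G_def)
    obtain M where M: "M \<subseteq> G" "inj_on (\<lambda>c. fst (fst c)) M" "inj_on (\<lambda>c. snd (fst c)) M"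
      and dom: "\<And>c. c \<in> G \<Longrightarrow> \<exists>d\<in>M. fst (fst d) = fst (fst c) \<and> v (fst c) (snd c) \<le> v (fst d) (snd d) \<or>
        snd (fst d) = snd (fst c) \<and> w (fst c) (snd c) \<le> w (fst d) (snd d)"
      using finite_stable_matching[OF \<open>finite G\<close>, of "\<lambda>c. fst (fst c)" "\<lambda>c. snd (fst c)"
          "\<lambda>c. v (fst c) (snd c)" "\<lambda>c. w (fst c) (snd c)"] by blast
    define L where "L = fst ` M"
    have injM: "inj_on fst M" using M(2) by (auto simp: inj_on_def)
    have "inj_on fst L" "inj_on snd L"
      using M(2,3) by (auto simp: L_def inj_on_def)
    moreover have "L \<subseteq> E" using M(1) \<open>G \<subseteq> Sigma E T\<close> by (auto simp: L_def)
    ultimately have "L \<in> LL" by (simp add: LL_def)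
    \<comment> \<open>On matched links the outcome follows \<open>M\<close>, which has at most one
      contract per link; on the other links of \<open>E\<close> any allowed contract will do, and
      off \<open>E\<close> the value must be the one prescribed by \<open>U\<close>.\<close>
    define x where "x e = (if e \<in> L then snd (inv_into M fst e)
      else if e \<in> E then SOME z. z \<in> T e else undefined)" for e
    have xM: "x (fst c) = snd c" if "c \<in> M" for c
      using that injM by (simp add: x_def L_def)
    have "x e \<in> U e" for e
    proof (cases "e \<in> L")
      case True
      then obtain c where "c \<in> M" "e = fst c" by (auto simp: L_def)
      then show ?thesis using xM M(1) \<open>G \<subseteq> Sigma E T\<close> by (auto simp: U_def)
    next
      case False
      then show ?thesis using nonempty[of e] by (auto simp: x_def U_def some_in_eq)
    qed
    then have "x \<in> K" unfolding K_def by (intro PiE_I) auto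
    moreover have "x \<in> N L c" if "c \<in> F L" for c
    proof -
      have "c \<in> G" using that \<open>L \<in> LL\<close> by (auto simp: G_def)
      from dom[OF this] obtain d where "d \<in> M"
        "fst (fst d) = fst (fst c) \<and> v (fst c) (snd c) \<le> v (fst d) (snd d) \<or>
         snd (fst d) = snd (fst c) \<and> w (fst c) (snd c) \<le> w (fst d) (snd d)"
        by blast
      with xM[of d] \<open>x \<in> K\<close> show ?thesis
        by (auto simp: N_def L_def intro!: bexI[of _ "fst d"])
    qed
    ultimately show False using F(3)[OF \<open>L \<in> LL\<close>] by blast
  qed
  then obtain L x where L: "L \<in> LL" and x: "x \<in> K" "\<And>c. c \<in> Sigma E T \<Longrightarrow> x \<in> N L c"
    by blast
  have "\<exists>d\<in>L. fst d = fst e \<and> v e z \<le> v d (x d) \<or> snd d = snd e \<and> w e z \<le> w d (x d)"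
    if "e \<in> E" "z \<in> T e" for e z
    using x(2)[of "(e, z)"] that by (auto simp: N_def)
  then show ?thesis
    using L K[OF x(1)] unfolding LL_def by blast
qed

subsection \<open>Exchange networks\<close>

lemma nbrs_sym: "j \<in> nbrs S i \<longleftrightarrow> i \<in> nbrs S j"
  by (auto simp: nbrs_def)

lemma payoff_Offer:
  assumes "p i = Offer j m m'"
  shows "payoff S p i =
    (if j \<in> nbrs S i \<and> p j = Offer i m' m then exchange_value S i j m m' else 0)"
  using assms by (simp add: payoff_def)

lemma nbrs_properties:
  assumes "exchange_network S" "j \<in> nbrs S i"
  shows "i \<in> actors S" "j \<in> actors S" "i \<noteq> j"
    and "capacity S i j = capacity S j i" "0 \<le> capacity S i j"
  using assms by (auto simp: exchange_network_def nbrs_def X_owners_def Y_owners_def)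

lemma feasible_sym:
  assumes "exchange_network S" "j \<in> nbrs S i"
  shows "feasible S i j m m' \<longleftrightarrow> feasible S j i m' m"
  using nbrs_properties[OF assms] by (auto simp: feasible_def add.commute)

text \<open>\<open>deal i j m m'\<close> says that \<open>i\<close> and \<open>j\<close> are matched, \<open>i\<close> giving \<open>m\<close> and \<open>j\<close> giving \<open>m'\<close>.\<close>

lemma stable_deals_exist:
  assumes S: "exchange_network S"
  obtains deal :: "'a \<Rightarrow> 'a \<Rightarrow> real \<Rightarrow> real \<Rightarrow> bool" where
    "\<And>i j m m'. deal i j m m' \<Longrightarrow> deal j i m' m"
    "\<And>i j k m m' n n'. deal i j m m' \<Longrightarrow> deal i k n n' \<Longrightarrow> j = k \<and> m = n \<and> m' = n'"
    "\<And>i j m m'. deal i j m m' \<Longrightarrow>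
      j \<in> nbrs S i \<and> feasible S i j m m' \<and> 0 \<le> exchange_value S i j m m'"
    "\<And>i j m m'. j \<in> nbrs S i \<Longrightarrow> feasible S i j m m' \<Longrightarrow>
      0 \<le> exchange_value S i j m m' \<Longrightarrow> 0 \<le> exchange_value S j i m' m \<Longrightarrow>
      (\<exists>k n n'. deal i k n n' \<and> exchange_value S i j m m' \<le> exchange_value S i k n n') \<or>
      (\<exists>k n n'. deal j k n n' \<and> exchange_value S j i m' m \<le> exchange_value S j k n n')"
proof -
  define v where "v e z = exchange_value S (fst e) (snd e) (fst z) (snd z)" for e z
  define w where "w e z = exchange_value S (snd e) (fst e) (snd z) (fst z)" for e z
  \<comment> \<open>The individually rational exchanges of a link. The zero exchange is always among
    them, and they form a closed subset of the compact box \<open>Q e\<close>.\<close>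
  define T where "T e = {z. feasible S (fst e) (snd e) (fst z) (snd z) \<and> 0 \<le> v e z \<and> 0 \<le> w e z}" for e
  let ?E = "links S"
  have sub: "?E \<subseteq> X_owners S \<times> Y_owners S" using S by (simp add: exchange_network_def)
  have fin: "finite ?E"
    by (rule finite_subset[OF sub]) (use S in \<open>auto simp: exchange_network_def X_owners_def Y_owners_def\<close>)
  define Q where "Q e = {0..amount S (fst e)} \<times> {0..amount S (snd e)}" for e
  have TQ: "T e \<subseteq> Q e" for e by (auto simp: T_def Q_def feasible_def)
  have cont: "continuous_on (Q e) (v e)" "continuous_on (Q e) (w e)" if "e \<in> ?E" for e
  proof -
    have u: "utility_function (utility S (fst e))" "utility_function (utility S (snd e))"
      using that sub S by (auto simp: exchange_network_def X_owners_def Y_owners_def)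
    show "continuous_on (Q e) (v e)"
      unfolding v_def
      by (rule continuous_on_subset[OF continuous_on_exchange_value[OF u(1)]]) (auto simp: Q_def)
    show "continuous_on (Q e) (w e)"
    proof -
      have "continuous_on (Q e) (\<lambda>z. (snd z, fst z))"
        by (intro continuous_intros)
      moreover have "(\<lambda>z. (snd z, fst z)) ` Q e \<subseteq> {0..amount S (snd e)} \<times> {0..}"
        by (auto simp: Q_def)
      ultimately show ?thesis
        using continuous_on_compose2[OF continuous_on_exchange_value[OF u(2), of "fst e"]]
        by (fastforce simp: w_def)
    qed
  qed
  have compact_T: "compact (T e)" if "e \<in> ?E" for e
  proof -
    have "compact (Q e)" by (simp add: Q_def compact_Times)
    then have "closed (Q e)" by (rule compact_imp_closed)
    have "T e = Q e \<inter> ({z \<in> Q e. fst z + snd z \<le> capacity S (fst e) (snd e)} \<inter>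
        {z \<in> Q e. 0 \<le> v e z} \<inter> {z \<in> Q e. 0 \<le> w e z})"
      by (auto simp: T_def Q_def feasible_def)
    also have "compact \<dots>"
      using \<open>closed (Q e)\<close> cont[OF that]
      by (intro compact_Int_closed \<open>compact (Q e)\<close> closed_Int continuous_on_closed_Collect_le
          continuous_intros)
    finally show ?thesis .
  qed
  have nonempty_T: "T e \<noteq> {}" if "e \<in> ?E" for e
  proof -
    have "(0, 0) \<in> T e"
      using that sub S by (auto simp: T_def v_def w_def feasible_def exchange_network_def
          X_owners_def Y_owners_def)
    then show ?thesis by blast
  qed
  have cont_T: "continuous_on (T e) (v e)" "continuous_on (T e) (w e)" if "e \<in> ?E" for e
    using cont[OF that] TQ[of e] continuous_on_subset by blast+
  have "\<exists>L x. L \<subseteq> ?E \<and> inj_on fst L \<and> inj_on snd L \<and> (\<forall>e\<in>?E. x e \<in> T e) \<and>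
    (\<forall>e\<in>?E. \<forall>z\<in>T e. \<exists>d\<in>L. fst d = fst e \<and> v e z \<le> v d (x d) \<or> snd d = snd e \<and> w e z \<le> w d (x d))"
    by (rule compact_stable_matching[OF fin compact_T nonempty_T cont_T])
  then obtain L x where L: "L \<subseteq> ?E" "inj_on fst L" "inj_on snd L"
    and x: "\<And>e. e \<in> ?E \<Longrightarrow> x e \<in> T e"
    and dom: "\<And>e z. e \<in> ?E \<Longrightarrow> z \<in> T e \<Longrightarrow>
      \<exists>d\<in>L. fst d = fst e \<and> v e z \<le> v d (x d) \<or> snd d = snd e \<and> w e z \<le> w d (x d)"
    by (elim exE conjE) blast
  \<comment> \<open>Links list the \<open>X\<close>-owner first; \<open>deal\<close> may be read
    from either end.\<close>
  define deal where "deal i j m m' \<longleftrightarrow>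
    (i, j) \<in> L \<and> x (i, j) = (m, m') \<or> (j, i) \<in> L \<and> x (j, i) = (m', m)" for i j m m'
  have "item_of S i = ItemX \<and> item_of S j = ItemY" if "(i, j) \<in> L" for i j
    using that subsetD[OF sub, of "(i, j)"] L(1) by (auto simp: X_owners_def Y_owners_def)
  \<comment> \<open>By bipartiteness an actor occurs on one side of \<open>L\<close> only, so
    injectivity of \<open>fst\<close> and \<open>snd\<close> on \<open>L\<close> leaves it at most
    one partner.\<close>
  then have disj: "\<not> ((i, j) \<in> L \<and> (k, i) \<in> L)" for i j k
    by (metis item.distinct(1))
  have stable: "(\<exists>k n n'. deal i k n n' \<and> exchange_value S i j m m' \<le> exchange_value S i k n n') \<or>
      (\<exists>k n n'. deal j k n n' \<and> exchange_value S j i m' m \<le> exchange_value S j k n n')"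
    if ij: "(i, j) \<in> ?E" and "feasible S i j m m'"
      "0 \<le> exchange_value S i j m m'" "0 \<le> exchange_value S j i m' m" for i j m m'
  proof -
    have "(m, m') \<in> T (i, j)" using that by (simp add: T_def v_def w_def)
    from dom[OF ij this] obtain a b where ab: "(a, b) \<in> L"
      "a = i \<and> v (i, j) (m, m') \<le> v (a, b) (x (a, b)) \<or> b = j \<and> w (i, j) (m, m') \<le> w (a, b) (x (a, b))"
      by auto
    obtain n n' where "x (a, b) = (n, n')" by fastforce
    with ab have "deal a b n n'" "deal b a n' n"
      "a = i \<and> exchange_value S i j m m' \<le> exchange_value S a b n n' \<or>
       b = j \<and> exchange_value S j i m' m \<le> exchange_value S b a n' n"
      by (auto simp: deal_def v_def w_def)
    then show ?thesis by blast
  qed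
  show thesis
  proof (rule that[of deal])
    show "deal j i m' m" if "deal i j m m'" for i j m m'
      using that by (auto simp: deal_def)
    show "j = k \<and> m = n \<and> m' = n'" if "deal i j m m'" "deal i k n n'" for i j k m m' n n'
      using that disj inj_onD[OF L(2), of "(i, j)" "(i, k)"] inj_onD[OF L(3), of "(j, i)" "(k, i)"]
      unfolding deal_def by auto
    show "j \<in> nbrs S i \<and> feasible S i j m m' \<and> 0 \<le> exchange_value S i j m m'"
      if "deal i j m m'" for i j m m'
    proof -
      have j: "j \<in> nbrs S i" using that L(1) by (auto simp: deal_def nbrs_def)
      have "feasible S a b c d \<and> 0 \<le> exchange_value S a b c d \<and> 0 \<le> exchange_value S b a d c"
        if "(a, b) \<in> L" "x (a, b) = (c, d)" for a b c d
        using x[of "(a, b)"] that L(1) by (auto simp: T_def v_def w_def)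
      then show ?thesis
        using that j feasible_sym[OF S j] unfolding deal_def by blast
    qed
    show "(\<exists>k n n'. deal i k n n' \<and> exchange_value S i j m m' \<le> exchange_value S i k n n') \<or>
      (\<exists>k n n'. deal j k n n' \<and> exchange_value S j i m' m \<le> exchange_value S j k n n')"
      if "j \<in> nbrs S i" "feasible S i j m m'"
        "0 \<le> exchange_value S i j m m'" "0 \<le> exchange_value S j i m' m" for i j m m'
      using that stable[of i j m m'] stable[of j i m' m] feasible_sym[OF S that(1)]
      unfolding nbrs_def by blast
  qed
qed

section \<open>From stable deals to a pair-wise stable profile\<close>

theorem theorem1:
  fixes S :: "'a network"
  assumes "exchange_network S"
    and "beneficial_links S"
  shows "\<exists>p\<in>profiles S. pairwise_stable S p"
proof (rule stable_deals_exist[OF assms(1)])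
  note S = assms(1)
  fix deal
  assume sym: "\<And>i j m m'. deal i j m m' \<Longrightarrow> deal j i m' m" and
    unique: "\<And>i j k m m' n n'. deal i j m m' \<Longrightarrow> deal i k n n' \<Longrightarrow> j = k \<and> m = n \<and> m' = n'" and
    rational: "\<And>i j m m'. deal i j m m' \<Longrightarrow>
      j \<in> nbrs S i \<and> feasible S i j m m' \<and> 0 \<le> exchange_value S i j m m'" and
    stable: "\<And>i j m m'. j \<in> nbrs S i \<Longrightarrow> feasible S i j m m' \<Longrightarrow>
      0 \<le> exchange_value S i j m m' \<Longrightarrow> 0 \<le> exchange_value S j i m' m \<Longrightarrow>
      (\<exists>k n n'. deal i k n n' \<and> exchange_value S i j m m' \<le> exchange_value S i k n n') \<or>
      (\<exists>k n n'. deal j k n n' \<and> exchange_value S j i m' m \<le> exchange_value S j k n n')"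
  note nb = nbrs_properties[OF S]
  have util: "utility_function (utility S i)" "0 \<le> amount S i" if "i \<in> actors S" for i
    using S that by (auto simp: exchange_network_def)

  \<comment> \<open>An unmatched actor with neighbours has no null strategy; it proposes the zero exchange, which
    is worthless to both sides even when it is accepted.\<close>
  define idle where "idle i = (if nbrs S i = {} then Null else Offer (SOME j. j \<in> nbrs S i) 0 0)" for i
  \<comment> \<open>The \<open>SOME\<close> has a single candidate, since an actor has at most one
    deal; \<open>undefined\<close> outside \<open>actors S\<close> is what the extensional product
    \<open>profiles S\<close> requires.\<close>
  define p where "p i = (if i \<notin> actors S then undefined
    else if \<exists>j m m'. deal i j m m'
      then SOME s. \<exists>j m m'. s = Offer j m m' \<and> deal i j m m'
    else idle i)" for i
  have p_deal: "p i = Offer j m m'" if "deal i j m m'" for i j m m'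
  proof -
    have "i \<in> actors S" using rational[OF that] nb(1) by blast
    moreover have ex: "\<exists>s j m m'. s = Offer j m m' \<and> deal i j m m'" using that by blast
    ultimately have "\<exists>k n n'. p i = Offer k n n' \<and> deal i k n n'"
      unfolding p_def using someI_ex[OF ex] by simp
    then show ?thesis using unique[OF that] by auto
  qed
  have p_cases: "(\<exists>j m m'. p i = Offer j m m' \<and> deal i j m m') \<or> p i = idle i" if "i \<in> actors S" for i
  proof (cases "\<exists>j m m'. deal i j m m'")
    case True
    then show ?thesis using p_deal by blast
  next
    case False
    then show ?thesis using that by (auto simp: p_def)
  qed
  have idle_in: "idle i \<in> strategies S i" if "i \<in> actors S" for i
  proof (cases "nbrs S i = {}")
    case False
    then have j: "(SOME j. j \<in> nbrs S i) \<in> nbrs S i" by (simp add: some_in_eq)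
    then have "feasible S i (SOME j. j \<in> nbrs S i) 0 0"
      using nb[OF j] util by (auto simp: feasible_def)
    then show ?thesis using False j by (simp add: idle_def strategies_def)
  qed (simp add: idle_def strategies_def)
  have "p i \<in> strategies S i" if "i \<in> actors S" for i
    using p_cases[OF that]
  proof (elim disjE exE conjE)
    fix j m m' assume "p i = Offer j m m'" "deal i j m m'"
    then show ?thesis using rational[of i j m m'] by (auto simp: strategies_def)
  qed (simp add: idle_in[OF that])
  then have p_in: "p \<in> profiles S"
    by (auto simp: profiles_def PiE_def extensional_def p_def)

  have payoff_deal: "payoff S p i = exchange_value S i j m m'" if "deal i j m m'" for i j m m'
    using p_deal[OF that] p_deal[OF sym[OF that]] rational[OF that] by (simp add: payoff_def)
  have payoff_idle: "payoff S p i = 0" if "p i = idle i" for i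
    using that by (simp add: payoff_def idle_def)
  have nonneg: "0 \<le> payoff S p i" if "i \<in> actors S" for i
    using p_cases[OF that]
  proof (elim disjE exE conjE)
    fix j m m' assume "deal i j m m'"
    then show ?thesis using rational[of i j m m'] payoff_deal[of i j m m'] by simp
  qed (simp add: payoff_idle)
  \<comment> \<open>If the partner addressed by \<open>i\<close> still plays as in \<open>p\<close>,
    then \<open>i\<close> can only accept an offer that stands in \<open>p\<close>. A nonzero payoff
    rules out the idle offer, so this is the deal that \<open>i\<close> already has. This covers
    unilateral deviations, and joint ones in which \<open>i\<close> does not address its
    co-deviator.\<close>
  have deviate: "payoff S q i \<le> payoff S p i"
    if "i \<in> actors S" and q: "\<And>j m m'. q i = Offer j m m' \<Longrightarrow> j \<in> nbrs S i \<Longrightarrow> q j = p j" for q i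
  proof (cases "payoff S q i = 0")
    case True
    then show ?thesis using nonneg[OF that(1)] by simp
  next
    case False
    then obtain j m m' where o: "q i = Offer j m m'" "j \<in> nbrs S i" "q j = Offer i m' m"
      "payoff S q i = exchange_value S i j m m'" "exchange_value S i j m m' \<noteq> 0"
      by (auto simp: payoff_def split: strategy.splits if_splits)
    have pj: "p j = Offer i m' m" using q o by simp
    moreover have "p j \<noteq> idle j"
      using pj o(5) by (auto simp: idle_def)
    ultimately have "deal j i m' m" using p_cases[OF nb(2)[OF o(2)]] by auto
    then show ?thesis using payoff_deal[OF sym] o(4) by simp
  qed
  have solo: "payoff S (p(i := s)) i \<le> payoff S p i" if "i \<in> actors S" for i s
    using that nb(3) by (intro deviate) auto
  have pair: "payoff S (p(i := s, j := s')) j < payoff S p j"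
    if "i \<in> actors S" and j: "j \<in> nbrs S i" and s: "s \<in> strategies S i"
      and gain: "payoff S (p(i := s, j := s')) i > payoff S p i" for i j s s'
  proof (rule ccontr)
    define q where "q = p(i := s, j := s')"
    assume "\<not> ?thesis"
    then have neg: "payoff S p j \<le> payoff S q j" by (simp add: q_def)
    have gain': "payoff S p i < payoff S q i" using gain by (simp add: q_def)
    have ij: "i \<noteq> j" "j \<in> actors S" "i \<in> nbrs S j"
      using nb(2,3)[OF j] j nbrs_sym[of j S i] by auto
    have q: "q i = s" "\<And>k. k \<noteq> i \<Longrightarrow> k \<noteq> j \<Longrightarrow> q k = p k" using ij by (auto simp: q_def)
    \<comment> \<open>By \<open>deviate\<close>, a gain requires addressing someone whose strategy
      changed, and that can only be \<open>j\<close>.\<close>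
    obtain k m m' where k: "q i = Offer k m m'" "k \<in> nbrs S i" "q k \<noteq> p k"
      using deviate[OF \<open>i \<in> actors S\<close>, of q] gain' by (meson not_less)
    have "k = j" using k(3) nb(3)[OF k(2)] q(2)[of k] by auto
    with k(1) have o: "q i = Offer j m m'" by simp
    have "payoff S q i \<noteq> 0" using gain' nonneg[OF that(1)] by simp
    then have qj: "q j = Offer i m' m"
      unfolding payoff_Offer[of q i, OF o] by (simp split: if_splits)
    have vi: "payoff S q i = exchange_value S i j m m'"
      unfolding payoff_Offer[of q i, OF o] using qj j by simp
    have vj: "payoff S q j = exchange_value S j i m' m"
      unfolding payoff_Offer[of q j, OF qj] using o ij by simp
    have "s = Offer j m m'" using o q(1) by simp
    then have feas: "feasible S i j m m'" using s j by (auto simp: strategies_def split: if_splits)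
    \<comment> \<open>Actor \<open>i\<close> asks for slightly less than \<open>m'\<close> and still
      gains; \<open>j\<close>, who did not lose before, now gains strictly. The exchange
      \<open>(m, k)\<close> is then strictly better for both, and individually rational because
      payoffs under \<open>p\<close> are nonnegative, which contradicts
      \<open>stable\<close>.\<close>
    obtain k where k: "0 \<le> k" "k < m'" "payoff S p i < exchange_value S i j m k"
      using exchange_value_receive_less[OF util(1)[OF \<open>i \<in> actors S\<close>], of m m' "payoff S p i" j]
        feas gain' vi nonneg[OF \<open>i \<in> actors S\<close>] by (auto simp: feasible_def)
    have less: "payoff S p j < exchange_value S j i k m"
      using exchange_value_strict_antimono[OF util(1)[OF ij(2)], of k m' m i] k feas neg vj
      by (auto simp: feasible_def)
    have "feasible S i j m k" using feas k by (auto simp: feasible_def)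
    then show False
      using stable[OF j, of m k] k(3) less nonneg[OF that(1)] nonneg[OF ij(2)]
      by (fastforce simp: payoff_deal)
  qed
  show ?thesis
    using p_in solo pair unfolding pairwise_stable_def by blast
qed

end
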